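(* Let $A$ be a finite Frobenius ring and $m\geq 1$. Let $\langle -,-\rangle:A^m\times A^m\to A$ be a non degenerate $A$-bilinear form such that the matrix $Q=(\langle e_i,e_j\rangle)_{1\leq i,j\leq m}$ is monomial, where $e_i\in A^m$ is the vector whose only nonzero component is the $i$-th, which is $1$. Let $C\subseteq A^m$ be a left (resp. right) $A$-linear code, and set $D=C'=\{y\in A^m:\langle c,y\rangle=0\ \forall c\in C\}$ (resp. $D={}'C=\{x\in A^m:\langle x,c\rangle=0\ \forall c\in C\}$). Then $$W_D(X,Y)=\frac{1}{|C|}W_C(X+(|A|-1)Y,\,X-Y).$$
   Context: All rings are unital and possibly noncommutative. A left and right artinian ring $A$ with Jacobson radical $J$ is called Frobenius if $\operatorname{Soc}({}_AA)\cong A/J$ as left $A$-modules and $\operatorname{Soc}(A_A)\cong A/J$ as right $A$-modules, where $\operatorname{Soc}$ denotes the socle. $A^m$ carries its canonical $A$-bimodule structure. A map $\langle -,-\rangle:A^m\times A^m\to A$ is $A$-bilinear if it is biadditive and $\langle ax,ya'\rangle=a\langle x,y\rangle a'$ for all $a,a'\in A$, $x,y\in A^m$. It is non degenerate if the only $x$ with $\langle x,y\rangle=0$ for all $y$ is $x=0$, and the only $y$ with $\langle x,y\rangle=0$ for all $x$ is $y=0$. A left (resp. right) $A$-linear code is a left (resp. right) $A$-submodule of $A^m$. A square matrix over a ring is monomial if each row and each column contains exactly one nonzero entry and that nonzero entry is a unit. The Hamming weight $wt(x)$ of $x\in A^m$ is the number of nonzero components of $x$. For an additive code $C\subseteq A^m$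 the Hamming weight enumerator is $W_C(X,Y)=\sum_{x\in C}X^{m-wt(x)}Y^{wt(x)}\in\mathbb{C}[X,Y]$. *)

theory Defs
  imports
    "HOL-Analysis.Analysis"
    "HOL-Computational_Algebra.Polynomial"
begin

text \<open>
  A module structure is given by an
  action \<open>smul\<close>.  Left modules over \<open>'a\<close> have \<open>smul a x = a x\<close>, right modules have
  \<open>smul a x = x a\<close>; the notions defined for a general action do not depend on the side.
\<close>

definition submodule :: "('a \<Rightarrow> 'v \<Rightarrow> 'v) \<Rightarrow> 'v::ab_group_add set \<Rightarrow> bool" where
  "submodule smul S \<longleftrightarrow>
     0 \<in> S \<and> (\<forall>x\<in>S. \<forall>y\<in>S. x + y \<in> S) \<and> (\<forall>x\<in>S. - x \<in> S) \<and> (\<forall>a. \<forall>x\<in>S. smul a x \<in> S)"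

definition simple_submodule :: "('a \<Rightarrow> 'v \<Rightarrow> 'v) \<Rightarrow> 'v::ab_group_add set \<Rightarrow> bool" where
  "simple_submodule smul S \<longleftrightarrow>
     submodule smul S \<and> S \<noteq> {0} \<and> (\<forall>T. submodule smul T \<and> T \<subseteq> S \<longrightarrow> T = {0} \<or> T = S)"

definition maximal_submodule :: "('a \<Rightarrow> 'v \<Rightarrow> 'v) \<Rightarrow> 'v::ab_group_add set \<Rightarrow> bool" where
  "maximal_submodule smul M \<longleftrightarrow>
     submodule smul M \<and> M \<noteq> UNIV \<and> (\<forall>T. submodule smul T \<and> M \<subseteq> T \<longrightarrow> T = M \<or> T = UNIV)"

definition artinian :: "('a \<Rightarrow> 'v \<Rightarrow> 'v::ab_group_add) \<Rightarrow> bool" where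
  "artinian smul \<longleftrightarrow>
     (\<forall>I :: nat \<Rightarrow> 'v set. (\<forall>n. submodule smul (I n)) \<and> (\<forall>n. I (Suc n) \<subseteq> I n)
        \<longrightarrow> (\<exists>N. \<forall>n\<ge>N. I n = I N))"

text \<open>The socle is the sum of all simple submodules, that is, the least submodule containing them.\<close>

definition socle :: "('a \<Rightarrow> 'v \<Rightarrow> 'v::ab_group_add) \<Rightarrow> 'v set" where
  "socle smul = \<Inter>{S. submodule smul S \<and> (\<forall>T. simple_submodule smul T \<longrightarrow> T \<subseteq> S)}"

definition modules_isomorphic ::
  "'v set \<Rightarrow> ('v \<Rightarrow> 'v \<Rightarrow> 'v) \<Rightarrow> ('a \<Rightarrow> 'v \<Rightarrow> 'v) \<Rightarrow>
   'w set \<Rightarrow> ('w \<Rightarrow> 'w \<Rightarrow> 'w) \<Rightarrow> ('a \<Rightarrow> 'w \<Rightarrow> 'w) \<Rightarrow> bool" where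
  "modules_isomorphic M addM smulM N addN smulN \<longleftrightarrow>
     (\<exists>f. bij_betw f M N \<and>
          (\<forall>x\<in>M. \<forall>y\<in>M. f (addM x y) = addN (f x) (f y)) \<and>
          (\<forall>a. \<forall>x\<in>M. f (smulM a x) = smulN a (f x)))"

definition cosets :: "'v::ab_group_add set \<Rightarrow> 'v set set" where
  "cosets J = range (\<lambda>x. {x + j | j. j \<in> J})"

definition coset_add :: "'v::ab_group_add set \<Rightarrow> 'v set \<Rightarrow> 'v set" where
  "coset_add U V = {u + v | u v. u \<in> U \<and> v \<in> V}"

text \<open>The action on the quotient by \<open>J\<close>: the coset of \<open>x\<close> is sent to the coset of \<open>smul a x\<close>.\<close>

definition coset_smul ::
  "'v::ab_group_add set \<Rightarrow> ('a \<Rightarrow> 'v \<Rightarrow> 'v) \<Rightarrow> 'a \<Rightarrow> 'v set \<Rightarrow> 'v set" where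
  "coset_smul J smul a U = {smul a u + j | u j. u \<in> U \<and> j \<in> J}"

definition lmul :: "'a::ring_1 \<Rightarrow> 'a \<Rightarrow> 'a" where
  "lmul a x = a * x"

definition rmul :: "'a::ring_1 \<Rightarrow> 'a \<Rightarrow> 'a" where
  "rmul a x = x * a"

definition jacobson_radical :: "'a::ring_1 set" where
  "jacobson_radical = \<Inter>{M. maximal_submodule lmul M}"

definition frobenius_ring :: "'a::ring_1 itself \<Rightarrow> bool" where
  "frobenius_ring _ \<longleftrightarrow>
     artinian (lmul :: 'a \<Rightarrow> 'a \<Rightarrow> 'a) \<and>
     artinian (rmul :: 'a \<Rightarrow> 'a \<Rightarrow> 'a) \<and>
     modules_isomorphic
       (socle (lmul :: 'a \<Rightarrow> 'a \<Rightarrow> 'a)) (+) lmul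
       (cosets jacobson_radical) coset_add (coset_smul jacobson_radical lmul) \<and>
     modules_isomorphic
       (socle (rmul :: 'a \<Rightarrow> 'a \<Rightarrow> 'a)) (+) rmul
       (cosets jacobson_radical) coset_add (coset_smul jacobson_radical rmul)"

text \<open>The right action on vectors; the left one is the library's \<open>a *s x\<close>.\<close>

definition vec_rmul :: "'a::ring_1 \<Rightarrow> 'a^'m \<Rightarrow> 'a^'m" where
  "vec_rmul a x = (\<chi> i. x $ i * a)"

definition left_linear_code :: "('a::ring_1^'m) set \<Rightarrow> bool" where
  "left_linear_code C \<longleftrightarrow> submodule (*s) C"

definition right_linear_code :: "('a::ring_1^'m) set \<Rightarrow> bool" where
  "right_linear_code C \<longleftrightarrow> submodule vec_rmul C"

text \<open>
  Left linear in the first argument and right linear in the second one; there is no condition on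
  \<open>\<beta> (vec_rmul a x) y\<close> or \<open>\<beta> x (a *s y)\<close>.
\<close>

definition bilinear_form :: "('a::ring_1^'m \<Rightarrow> 'a^'m \<Rightarrow> 'a) \<Rightarrow> bool" where
  "bilinear_form \<beta> \<longleftrightarrow>
     (\<forall>x x' y. \<beta> (x + x') y = \<beta> x y + \<beta> x' y) \<and>
     (\<forall>x y y'. \<beta> x (y + y') = \<beta> x y + \<beta> x y') \<and>
     (\<forall>a a' x y. \<beta> (a *s x) (vec_rmul a' y) = a * \<beta> x y * a')"

definition nondegenerate :: "('a::ring_1^'m \<Rightarrow> 'a^'m \<Rightarrow> 'a) \<Rightarrow> bool" where
  "nondegenerate \<beta> \<longleftrightarrow>
     (\<forall>x. (\<forall>y. \<beta> x y = 0) \<longrightarrow> x = 0) \<and> (\<forall>y. (\<forall>x. \<beta> x y = 0) \<longrightarrow> y = 0)"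

definition gram_matrix :: "('a::ring_1^'m \<Rightarrow> 'a^'m \<Rightarrow> 'a) \<Rightarrow> 'a^'m^'m" where
  "gram_matrix \<beta> = (\<chi> i j. \<beta> (axis i 1) (axis j 1))"

text \<open>Divisibility of \<open>1\<close> is one-sided in a noncommutative ring, so units are spelled out.\<close>

definition monomial_matrix :: "'a::ring_1^'m^'m \<Rightarrow> bool" where
  "monomial_matrix Q \<longleftrightarrow>
     (\<forall>i. \<exists>!j. Q $ i $ j \<noteq> 0) \<and>
     (\<forall>j. \<exists>!i. Q $ i $ j \<noteq> 0) \<and>
     (\<forall>i j. Q $ i $ j \<noteq> 0 \<longrightarrow> (\<exists>v. Q $ i $ j * v = 1 \<and> v * Q $ i $ j = 1))"

definition right_orthogonal :: "('a::ring_1^'m \<Rightarrow> 'a^'m \<Rightarrow> 'a) \<Rightarrow> ('a^'m) set \<Rightarrow> ('a^'m) set" where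
  "right_orthogonal \<beta> C = {y. \<forall>c\<in>C. \<beta> c y = 0}"

definition left_orthogonal :: "('a::ring_1^'m \<Rightarrow> 'a^'m \<Rightarrow> 'a) \<Rightarrow> ('a^'m) set \<Rightarrow> ('a^'m) set" where
  "left_orthogonal \<beta> C = {x. \<forall>c\<in>C. \<beta> x c = 0}"

text \<open>
  \<open>\<complex>[X,Y]\<close> is rendered as \<open>\<complex>[X][Y]\<close>: \<open>X\<close> is the variable of the coefficient ring.
\<close>

type_synonym bipoly = "complex poly poly"

definition bX :: bipoly where
  "bX = [:[:0, 1:]:]"

definition bY :: bipoly where
  "bY = [:0, 1:]"

definition bconst :: "complex \<Rightarrow> bipoly" where
  "bconst c = [:[:c:]:]"

text \<open>\<open>bsubst p U V\<close> is \<open>p(U,V)\<close>, the result of substituting \<open>U\<close> for \<open>X\<close> and \<open>V\<close> for \<open>Y\<close>.\<close>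

definition bsubst :: "bipoly \<Rightarrow> bipoly \<Rightarrow> bipoly \<Rightarrow> bipoly" where
  "bsubst p U V = poly (map_poly (\<lambda>q. poly (map_poly bconst q) U) p) V"

definition hamming_weight :: "'a::zero^'m \<Rightarrow> nat" where
  "hamming_weight x = card {i. x $ i \<noteq> 0}"

definition weight_enumerator :: "('a::zero^'m) set \<Rightarrow> bipoly" where
  "weight_enumerator C =
     (\<Sum>x\<in>C. bX ^ (CARD('m) - hamming_weight x) * bY ^ hamming_weight x)"

lemma bconst_0 [simp]: "bconst 0 = 0"
  by (simp add: bconst_def)

lemma bsubst_0 [simp]: "bsubst 0 U V = 0"
  by (simp add: bsubst_def)

lemma bsubst_add: "bsubst (p + q) U V = bsubst p U V + bsubst q U V"
proof -
  have 1: "map_poly bconst (r + s) = map_poly bconst r + map_poly bconst s" for r s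
    by (intro poly_eqI) (simp add: coeff_map_poly bconst_def)
  have "map_poly (\<lambda>q. poly (map_poly bconst q) U) (p + q) =
        map_poly (\<lambda>q. poly (map_poly bconst q) U) p + map_poly (\<lambda>q. poly (map_poly bconst q) U) q"
    by (intro poly_eqI) (simp add: coeff_map_poly 1)
  then show ?thesis
    by (simp add: bsubst_def)
qed

lemma bsubst_monomial: "bsubst (bX ^ k * bY ^ l) U V = U ^ k * V ^ l"
proof -
  have "bX ^ k * bY ^ l = monom (monom 1 k) l"
  proof -
    have "bX ^ k = [:monom 1 k:]"
      by (simp add: bX_def monom_altdef poly_const_pow)
    moreover have "bY ^ l = monom 1 l"
      by (simp add: bY_def monom_altdef)
    ultimately show ?thesis
      by (simp add: smult_monom)
  qed
  moreover have "bconst 1 = 1"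
    by (simp add: bconst_def one_pCons)
  ultimately show ?thesis
    by (simp add: bsubst_def map_poly_monom poly_monom)
qed

lemma bsubst_weight_enumerator:
  fixes C :: "('a::zero^'m) set"
  shows "bsubst (weight_enumerator C) U V =
    (\<Sum>x\<in>C. U ^ (CARD('m) - hamming_weight x) * V ^ hamming_weight x)"
proof -
  have "bsubst (sum f S) U V = (\<Sum>x\<in>S. bsubst (f x) U V)" for f and S :: "('a^'m) set"
    by (induction S rule: infinite_finite_induct) (simp_all add: bsubst_add)
  then show ?thesis
    by (simp add: weight_enumerator_def bsubst_monomial)
qed

end

theory Submission
  imports Defs
begin

text \<open>
  A finite Frobenius ring \<open>A\<close> with radical \<open>J\<close> has an additive character \<open>\<kappa>\<close> whose kernel contains no
  nonzero one-sided ideal.  Indeed, some character of \<open>A/J\<close> has no nonzero left ideal in its kernel;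
  it is pulled back to the left socle along \<open>Soc(A) \<cong> A/J\<close> and extended to \<open>A\<close>.  A nonzero left ideal
  in the kernel would contain a simple one, which lies in the socle.  The largest left and the largest
  right ideal in the kernel of a character have the same size, so right ideals are excluded as well.

  With such a \<open>\<kappa>\<close>, summing \<open>\<kappa> (\<beta> c y)\<close> over \<open>c \<in> C\<close> detects whether \<open>y\<close> is orthogonal to \<open>C\<close>, and the sum
  over \<open>y\<close> factors over the coordinates as in the classical proof of MacWilliams' identity; since the
  Gram matrix is monomial, \<open>c \<mapsto> c Q\<close> preserves the Hamming weight.
\<close>

section \<open>Characters of finite additive groups\<close>

definition add_subgroup :: "'v::ab_group_add set \<Rightarrow> bool" where
  "add_subgroup H \<longleftrightarrow> 0 \<in> H \<and> (\<forall>x\<in>H. \<forall>y\<in>H. x + y \<in> H) \<and> (\<forall>x\<in>H. - x \<in> H)"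

text \<open>Only the values on \<open>H\<close> are constrained. The clause \<open>f 0 = 1\<close>
  excludes the zero function and, on a subgroup, makes every value invertible.\<close>

definition character_on :: "'v::ab_group_add set \<Rightarrow> ('v \<Rightarrow> complex) \<Rightarrow> bool" where
  "character_on H f \<longleftrightarrow> f 0 = 1 \<and> (\<forall>x\<in>H. \<forall>y\<in>H. f (x + y) = f x * f y)"

lemma add_subgroup_UNIV [simp]: "add_subgroup UNIV"
  by (simp add: add_subgroup_def)

lemma add_subgroup_diff:
  "add_subgroup H \<Longrightarrow> x \<in> H \<Longrightarrow> y \<in> H \<Longrightarrow> x - y \<in> H"
  unfolding add_subgroup_def by (metis diff_conv_add_uminus)

lemma submodule_add_subgroup: "submodule smul S \<Longrightarrow> add_subgroup S"
  by (simp add: submodule_def add_subgroup_def)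

text \<open>Translation by an element \<open>u\<close> with \<open>f u \<noteq> 1\<close> permutes
  \<open>G\<close> and multiplies the sum by \<open>f u\<close>, so the sum over a nontrivial
  character vanishes.\<close>

lemma sum_character_on:
  assumes "finite G" "add_subgroup G" "character_on G f"
  shows "(\<Sum>x\<in>G. f x) = (if \<forall>x\<in>G. f x = 1 then of_nat (card G) else 0)"
proof (cases "\<forall>x\<in>G. f x = 1")
  case False
  then obtain u where u: "u \<in> G" "f u \<noteq> 1" by auto
  have "bij_betw (\<lambda>x. u + x) G G"
    by (rule bij_betwI[where g = "\<lambda>x. x - u"])
      (use assms u in \<open>auto simp: add_subgroup_diff\<close>, auto simp: add_subgroup_def)
  then have "(\<Sum>x\<in>G. f x) = (\<Sum>x\<in>G. f (u + x))"
    by (simp add: sum.reindex_bij_betw)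
  also have "\<dots> = f u * (\<Sum>x\<in>G. f x)"
    using assms u by (simp add: character_on_def sum_distrib_left)
  finally show ?thesis using u False by auto
qed simp

lemma character_on_sum:
  assumes "character_on UNIV f"
  shows "f (\<Sum>i\<in>S. g i) = (\<Prod>i\<in>S. f (g i))"
  using assms by (induction S rule: infinite_finite_induct) (auto simp: character_on_def)

section \<open>Extension of characters from subgroups of the additive group of a ring\<close>

lemma add_subgroup_of_nat_mult:
  assumes "add_subgroup H" "(h::'a::ring_1) \<in> H"
  shows "of_nat q * h \<in> H"
  using assms by (induction q) (auto simp: add_subgroup_def distrib_right)

lemma character_on_of_nat_mult:
  assumes "add_subgroup H" "character_on H f" "(h::'a::ring_1) \<in> H"
  shows "f (of_nat q * h) = f h ^ q"
proof (induction q)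
  case (Suc q)
  have "f (of_nat (Suc q) * h) = f (h + of_nat q * h)" by (simp add: distrib_right)
  also have "\<dots> = f h * f (of_nat q * h)"
    using assms add_subgroup_of_nat_mult[OF assms(1,3), of q] by (simp add: character_on_def)
  finally show ?case using Suc by simp
qed (use assms in \<open>simp add: character_on_def\<close>)

lemma complex_root_exists:
  assumes "n > 0"
  shows "\<exists>z::complex. z ^ n = w"
proof (cases "w = 0")
  case False
  then have "card {z::complex. z ^ n = w} = n" using assms by (intro card_nth_roots) auto
  then have "{z::complex. z ^ n = w} \<noteq> {}" using assms by (metis card.empty less_irrefl)
  then show ?thesis by blast
qed (use assms in \<open>auto intro: exI[of _ 0]\<close>)

text \<open>Extending by one element \<open>x\<close> leaves a free choice among the \<open>n\<close>-th roots of \<open>f (n x)\<close>.\<close>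

lemma character_on_adjoin:
  fixes x :: "'a::{ring_1,finite}"
  assumes H: "add_subgroup H" and f: "character_on H f" and x: "x \<notin> H"
  obtains n :: nat where "n \<ge> 2" "of_nat n * x \<in> H"
    "\<And>z. z ^ n = f (of_nat n * x) \<Longrightarrow>
       \<exists>H' g. add_subgroup H' \<and> H \<subset> H' \<and> x \<in> H' \<and> character_on H' g \<and> (\<forall>h\<in>H. g h = f h) \<and> g x = z"
proof -
  have Ha: "a + b \<in> H" if "a \<in> H" "b \<in> H" for a b using H that by (simp add: add_subgroup_def)
  have Hn: "- a \<in> H" if "a \<in> H" for a using H that by (simp add: add_subgroup_def)
  have H0: "0 \<in> H" using H by (simp add: add_subgroup_def)
  have fm: "f (a + b) = f a * f b" if "a \<in> H" "b \<in> H" for a b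
    using f that by (simp add: character_on_def)
  have f0: "f 0 = 1" using f by (simp add: character_on_def)
  have p: "CHAR('a) > 0" by (rule finite_imp_CHAR_pos) simp
  define P where "P n \<longleftrightarrow> n > 0 \<and> of_nat n * x \<in> H" for n :: nat
  \<comment> \<open>\<open>n\<close> is the order of \<open>x\<close> modulo \<open>H\<close>; it
    exists because the characteristic annihilates \<open>x\<close>.\<close>
  define n where "n = (LEAST n. P n)"
  have "P CHAR('a)" using p H0 by (simp add: P_def)
  then have Pn: "P n" unfolding n_def by (rule LeastI)
  have min: "\<not> P k" if "k < n" for k using that unfolding n_def by (rule not_less_Least)
  have nH: "of_nat n * x \<in> H" and n0: "n > 0" using Pn by (auto simp: P_def)
  have "n \<noteq> 1" using nH x by auto
  with n0 have n2: "n \<ge> 2" by simp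
  \<comment> \<open>Otherwise the remainder of \<open>k\<close> modulo \<open>n\<close> would be a
    smaller positive multiplier taking \<open>x\<close> into \<open>H\<close>.\<close>
  have dvd: "n dvd k" if k: "of_nat k * x \<in> H" for k
  proof -
    have "of_nat k * x = of_nat (k div n) * (of_nat n * x) + of_nat (k mod n) * x"
      by (metis add.commute distrib_right div_mult_mod_eq mult.assoc of_nat_add of_nat_mult)
    then have "of_nat (k mod n) * x = of_nat k * x - of_nat (k div n) * (of_nat n * x)"
      by simp
    then have "of_nat (k mod n) * x \<in> H"
      using add_subgroup_diff[OF H k add_subgroup_of_nat_mult[OF H nH]] by simp
    then show ?thesis
      using min[of "k mod n"] n0 by (auto simp: P_def)
  qed
  have "\<exists>H' g. add_subgroup H' \<and> H \<subset> H' \<and> x \<in> H' \<and> character_on H' g \<and> (\<forall>h\<in>H. g h = f h) \<and> g x = z"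
    if z: "z ^ n = f (of_nat n * x)" for z
  proof -
    \<comment> \<open>Two representations of one element differ by trading a multiple of
      \<open>of_nat n * x\<close> for an element of \<open>H\<close>; the choice of \<open>z\<close>
      makes the candidate values agree.\<close>
    have le: "f h * z ^ k = f h' * z ^ k'"
      if "h \<in> H" "h' \<in> H" and eq: "h + of_nat k * x = h' + of_nat k' * x" and "k \<le> k'" for h h' k k'
    proof -
      have d: "of_nat (k' - k) * x = h - h'"
        using eq \<open>k \<le> k'\<close> by (simp add: of_nat_diff algebra_simps)
      then have "of_nat (k' - k) * x \<in> H" using that H by (simp add: add_subgroup_diff)
      from dvd[OF this] obtain q where q: "k' - k = n * q" by (auto elim: dvdE)
      have "h = h' + of_nat q * (of_nat n * x)"
        using d q by (metis add.commute diff_add_cancel mult.assoc mult.commute of_nat_mult)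
      then have "f h = f h' * (z ^ n) ^ q"
        using fm[OF \<open>h' \<in> H\<close> add_subgroup_of_nat_mult[OF H nH]]
          character_on_of_nat_mult[OF H f nH] z by simp
      also have "(z ^ n) ^ q = z ^ (k' - k)" by (simp add: q power_mult)
      finally show ?thesis
        using \<open>k \<le> k'\<close> by (simp add: mult.assoc flip: power_add)
    qed
    have wd: "f h * z ^ k = f h' * z ^ k'"
      if "h \<in> H" "h' \<in> H" "h + of_nat k * x = h' + of_nat k' * x" for h h' k k'
      using le[of h h' k k'] le[of h' h k' k] that by (metis nat_le_linear)
    define H' where "H' = {h + of_nat k * x | h k. h \<in> H}"
    define g where "g y = (SOME w. \<exists>h k. h \<in> H \<and> y = h + of_nat k * x \<and> w = f h * z ^ k)" for y
    have g: "g (h + of_nat k * x) = f h * z ^ k" if h: "h \<in> H" for h k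
      unfolding g_def
    proof (rule some_equality)
      show "\<exists>h' k'. h' \<in> H \<and> h + of_nat k * x = h' + of_nat k' * x \<and> f h * z ^ k = f h' * z ^ k'"
        using h by blast
    qed (use wd[OF h] in metis)
    have gH: "g h = f h" if "h \<in> H" for h using g[OF that, of 0] by simp
    have gx: "g x = z" using g[OF H0, of 1] f0 by simp
    have sub: "add_subgroup H'"
      unfolding add_subgroup_def
    proof (intro conjI ballI)
      show "0 \<in> H'" unfolding H'_def using H0 by (force intro: exI[of _ "0::nat"])
    next
      fix a b assume "a \<in> H'" "b \<in> H'"
      then obtain h k h' k' where *: "a = h + of_nat k * x" "b = h' + of_nat k' * x" "h \<in> H" "h' \<in> H"
        unfolding H'_def by blast
      have "a + b = (h + h') + of_nat (k + k') * x" using * by (simp add: algebra_simps)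
      then show "a + b \<in> H'" unfolding H'_def using Ha * by blast
    next
      fix a assume "a \<in> H'"
      then obtain h k where *: "a = h + of_nat k * x" "h \<in> H"
        unfolding H'_def by blast
      \<comment> \<open>\<open>H'\<close> uses natural coefficients only; modulo the characteristic,
        \<open>k * (CHAR('a) - 1)\<close> represents the negative of \<open>k\<close>.\<close>
      have "of_nat k + of_nat (k * (CHAR('a) - 1)) = (of_nat (k * CHAR('a)) :: 'a)"
        using p by (metis One_nat_def Suc_pred mult_Suc_right of_nat_add)
      then have "of_nat (k * (CHAR('a) - 1)) = - (of_nat k :: 'a)"
        by (simp add: eq_neg_iff_add_eq_0 add.commute)
      then have "- a = (- h) + of_nat (k * (CHAR('a) - 1)) * x"
        using * by simp
      then show "- a \<in> H'" unfolding H'_def using Hn * by blast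
    qed
    have ch: "character_on H' g"
      unfolding character_on_def
    proof (intro conjI ballI)
      show "g 0 = 1" using gH[OF H0] f0 by simp
    next
      fix a b assume "a \<in> H'" "b \<in> H'"
      then obtain h k h' k' where *: "a = h + of_nat k * x" "b = h' + of_nat k' * x" "h \<in> H" "h' \<in> H"
        unfolding H'_def by blast
      have "a + b = (h + h') + of_nat (k + k') * x" using * by (simp add: algebra_simps)
      then have "g (a + b) = f (h + h') * z ^ (k + k')" using g Ha * by metis
      then show "g (a + b) = g a * g b" using * g fm by (simp add: power_add)
    qed
    have "h \<in> H'" if "h \<in> H" for h
      unfolding H'_def using that by (force intro: exI[of _ "0::nat"])
    moreover have xH: "x \<in> H'" unfolding H'_def using H0 by (force intro: exI[of _ "1::nat"])
    ultimately have "H \<subset> H'" using x by blast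
    then show ?thesis using sub ch gH gx xH by blast
  qed
  then show ?thesis using that n2 nH by blast
qed

text \<open>One element is adjoined at a time: the complex numbers supply the root demanded at each
  step, and the complement of the domain shrinks.\<close>

lemma character_on_extend:
  fixes H :: "'a::{ring_1,finite} set"
  assumes "add_subgroup H" "character_on H f"
  shows "\<exists>g. character_on UNIV g \<and> (\<forall>h\<in>H. g h = f h)"
  using assms
proof (induction "card (- H)" arbitrary: H f rule: less_induct)
  case less
  show ?case
  proof (cases "H = UNIV")
    case False
    then obtain x where "x \<notin> H" by blast
    then obtain n where n: "n \<ge> 2"
      "\<And>z. z ^ n = f (of_nat n * x) \<Longrightarrow>
       \<exists>H' g. add_subgroup H' \<and> H \<subset> H' \<and> x \<in> H' \<and> character_on H' g \<and> (\<forall>h\<in>H. g h = f h) \<and> g x = z"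
      using character_on_adjoin[OF less.prems] by metis
    obtain z where "z ^ n = f (of_nat n * x)"
      using n(1) complex_root_exists[of n] by force
    from n(2)[OF this] obtain H' g where
      g: "add_subgroup H'" "H \<subset> H'" "character_on H' g" "\<forall>h\<in>H. g h = f h" by blast
    have "card (- H') < card (- H)" using g(2) by (intro psubset_card_mono) auto
    from less.hyps[OF this g(1,3)] show ?thesis using g(2,4) by fastforce
  qed (use less.prems in auto)
qed

text \<open>The trivial character of \<open>H\<close> is extended to \<open>x\<close> by a
  nontrivial \<open>n\<close>-th root of unity, which exists because
  \<open>n \<ge> 2\<close>.\<close>

lemma character_separates:
  fixes H :: "'a::{ring_1,finite} set"
  assumes "add_subgroup H" "x \<notin> H"
  obtains g where "character_on UNIV g" "\<forall>h\<in>H. g h = 1" "g x \<noteq> 1"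
proof -
  have c: "character_on H (\<lambda>_. 1)" by (simp add: character_on_def)
  obtain n where n: "n \<ge> 2"
    "\<And>z. z ^ n = 1 \<Longrightarrow>
       \<exists>H' g. add_subgroup H' \<and> H \<subset> H' \<and> x \<in> H' \<and> character_on H' g \<and> (\<forall>h\<in>H. g h = 1) \<and> g x = z"
    using character_on_adjoin[OF assms(1) c assms(2)] by metis
  have "card {z::complex. z ^ n = 1} = n" using n(1) by (intro card_roots_unity_eq) simp
  then have "\<not> {z::complex. z ^ n = 1} \<subseteq> {1}"
    using n(1) by (metis card.empty card_1_singleton_iff subset_singletonD not_less_eq_eq numeral_2_eq_2 One_nat_def zero_le)
  then obtain z :: complex where z: "z ^ n = 1" "z \<noteq> 1" by blast
  from n(2)[OF z(1)] obtain H' g where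
    g: "add_subgroup H'" "H \<subset> H'" "x \<in> H'" "character_on H' g" "\<forall>h\<in>H. g h = 1" "g x = z" by blast
  from character_on_extend[OF g(1,4)] obtain g' where
    "character_on UNIV g'" "\<forall>h\<in>H'. g' h = g h" by blast
  then show ?thesis using g z by (intro that[of g']) auto
qed

section \<open>The radical of a finite ring\<close>

text \<open>It carries nilpotency from \<open>v * u\<close> to \<open>u * v\<close>, hence between
  left and right multiples of an element.\<close>

lemma power_mult_swap:
  fixes u v :: "'a::monoid_mult"
  shows "(u * v) ^ Suc n = u * (v * u) ^ n * v"
  by (induction n) (simp_all add: mult.assoc power_commutes)

text \<open>The powers of \<open>a\<close> are eventually periodic, so an exponent that is a
  multiple of the period and lies beyond the preperiod gives an idempotent.\<close>

lemma finite_monoid_power_idempotent: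
  fixes a :: "'a::{monoid_mult,finite}"
  obtains n where "n > 0" "a ^ n * a ^ n = a ^ n"
proof -
  have "\<not> inj (\<lambda>n::nat. a ^ n)"
    using finite_imageD[of "\<lambda>n. a ^ n" "UNIV :: nat set"] by (auto intro: finite_subset[OF subset_UNIV])
  then obtain i j :: nat where ij: "i < j" "a ^ i = a ^ j"
    unfolding inj_def by (metis nat_neq_iff)
  define d where "d = j - i"
  have d: "a ^ (k + d) = a ^ k" if "k \<ge> i" for k
  proof -
    have "a ^ (k + d) = a ^ (k - i) * a ^ j"
      unfolding power_add[symmetric] using that ij d_def by simp
    also have "\<dots> = a ^ k"
      unfolding ij(2)[symmetric] power_add[symmetric] using that by simp
    finally show ?thesis .
  qed
  have dq: "a ^ (k + q * d) = a ^ k" if "k \<ge> i" for k q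
  proof (induction q)
    case (Suc q)
    then show ?case using d[of "k + q * d"] that by (simp add: ac_simps)
  qed simp
  have "d > 0" using ij d_def by simp
  \<comment> \<open>Taking \<open>i + 1\<close> periods instead of \<open>i\<close> keeps the
    exponent positive when \<open>i = 0\<close>.\<close>
  then have "(i + 1) * d \<ge> i + 1" by (cases d) auto
  then have "(i + 1) * d \<ge> i" "(i + 1) * d > 0" by auto
  with dq[of "(i + 1) * d" "i + 1"] show ?thesis
    by (intro that[of "(i + 1) * d"]) (simp_all add: power_add)
qed

lemma ex_maximal_left_ideal:
  fixes L :: "'a::{ring_1,finite} set"
  assumes "submodule lmul L" "L \<noteq> UNIV"
  obtains M where "maximal_submodule lmul M" "L \<subseteq> M"
proof -
  obtain M where "submodule lmul M" "M \<noteq> UNIV" "L \<subseteq> M"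
    "\<And>T. submodule lmul T \<and> T \<noteq> UNIV \<Longrightarrow> M \<subseteq> T \<Longrightarrow> M = T"
    using finite_has_maximal2[of "{M. submodule lmul M \<and> M \<noteq> UNIV}" L] assms by auto
  then show ?thesis by (intro that[of M]) (auto simp: maximal_submodule_def)
qed

lemma ex_simple_left_ideal:
  fixes L :: "'a::{ring_1,finite} set"
  assumes "submodule lmul L" "L \<noteq> {0}"
  obtains T where "simple_submodule lmul T" "T \<subseteq> L"
proof -
  obtain T where "submodule lmul T" "T \<noteq> {0}" "T \<subseteq> L"
    "\<And>U. submodule lmul U \<and> U \<noteq> {0} \<Longrightarrow> U \<subseteq> T \<Longrightarrow> T = U"
    using finite_has_minimal2[of "{M. submodule lmul M \<and> M \<noteq> {0}}" L] assms by auto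
  then show ?thesis by (intro that[of T]) (auto simp: simple_submodule_def)
qed

text \<open>For \<open>x\<close> in the radical, an idempotent power \<open>e\<close> of
  \<open>a * x\<close> lies in every maximal left ideal, so \<open>1 - e\<close> lies in none and
  has a left inverse, which forces \<open>e = 0\<close>. Conversely, \<open>x \<notin> M\<close>
  yields \<open>1 = a * x + m\<close>, and nilpotency of \<open>a * x\<close> puts \<open>1\<close>
  into \<open>M\<close>.\<close>

lemma jacobson_radical_iff:
  fixes x :: "'a::{ring_1,finite}"
  shows "x \<in> jacobson_radical \<longleftrightarrow> (\<forall>a. \<exists>n. (a * x) ^ n = 0)"
proof
  assume x: "x \<in> jacobson_radical"
  show "\<forall>a. \<exists>n. (a * x) ^ n = 0"
  proof
    fix a
    obtain n where n: "n > 0" "(a * x) ^ n * (a * x) ^ n = (a * x) ^ n"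
      by (rule finite_monoid_power_idempotent)
    define e where "e = (a * x) ^ n"
    define L where "L = range (\<lambda>y. y * (1 - e))"
    have L: "submodule lmul L"
      unfolding submodule_def
    proof (intro conjI ballI allI)
      show "0 \<in> L" unfolding L_def by (force intro: image_eqI[of _ _ 0])
    next
      fix u v assume "u \<in> L" "v \<in> L"
      then obtain y w where "u = y * (1 - e)" "v = w * (1 - e)" unfolding L_def by blast
      then have "u + v = (y + w) * (1 - e)" by (simp add: distrib_right)
      then show "u + v \<in> L" unfolding L_def by blast
    next
      fix u assume "u \<in> L"
      then obtain y where "u = y * (1 - e)" unfolding L_def by blast
      then have "- u = (- y) * (1 - e)" by simp
      then show "- u \<in> L" unfolding L_def by blast
    next
      fix b u assume "u \<in> L"
      then obtain y where "u = y * (1 - e)" unfolding L_def by blast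
      then have "lmul b u = (b * y) * (1 - e)" by (simp add: lmul_def mult.assoc)
      then show "lmul b u \<in> L" unfolding L_def by blast
    qed
    have "L = UNIV"
    proof (rule ccontr)
      assume "L \<noteq> UNIV"
      with L obtain M where M: "maximal_submodule lmul M" "L \<subseteq> M"
        by (rule ex_maximal_left_ideal)
      then have sub: "submodule lmul M" "M \<noteq> UNIV" by (auto simp: maximal_submodule_def)
      have xM: "x \<in> M" using x M(1) by (auto simp: jacobson_radical_def)
      have mulM: "b * y \<in> M" if "y \<in> M" for b y
        using sub that by (auto simp: submodule_def lmul_def)
      have "e = ((a * x) ^ (n - 1) * a) * x"
        unfolding e_def using n(1) by (metis Suc_diff_1 mult.assoc power_Suc2)
      then have "e \<in> M" using mulM[OF xM] by metis
      moreover have "1 - e \<in> M"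
      proof -
        have "1 * (1 - e) \<in> L" unfolding L_def by blast
        then show ?thesis using M(2) by auto
      qed
      ultimately have "(1 - e) + e \<in> M" using sub(1) unfolding submodule_def by blast
      then have "1 \<in> M" by simp
      then have "b \<in> M" for b using mulM[of 1 b] by simp
      then show False using sub(2) by auto
    qed
    then obtain y where y: "1 = y * (1 - e)" unfolding L_def by blast
    have "e = y * (1 - e) * e" using y by simp
    also have "\<dots> = y * (e - e * e)" by (simp add: algebra_simps)
    also have "\<dots> = 0" using n by (simp add: e_def)
    finally show "\<exists>n. (a * x) ^ n = 0" unfolding e_def by blast
  qed
next
  assume nil: "\<forall>a. \<exists>n. (a * x) ^ n = 0"
  have "x \<in> M" if M: "maximal_submodule lmul M" for M
  proof (rule ccontr)
    assume xM: "x \<notin> M"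
    have sub: "submodule lmul M" "M \<noteq> UNIV" using M by (auto simp: maximal_submodule_def)
    have M0: "0 \<in> M" and Ma: "\<And>u v. u \<in> M \<Longrightarrow> v \<in> M \<Longrightarrow> u + v \<in> M"
      and Mn: "\<And>u. u \<in> M \<Longrightarrow> - u \<in> M" and Mm: "\<And>b u. u \<in> M \<Longrightarrow> b * u \<in> M"
      using sub(1) by (auto simp: submodule_def lmul_def)
    define T where "T = {a * x + m | a m. m \<in> M}"
    have "submodule lmul T"
      unfolding submodule_def
    proof (intro conjI ballI allI)
      show "0 \<in> T" unfolding T_def using M0 by (force intro: exI[of _ 0])
    next
      fix u v assume "u \<in> T" "v \<in> T"
      then obtain a m b l where "u = a * x + m" "v = b * x + l" "m \<in> M" "l \<in> M"
        unfolding T_def by blast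
      then have "u + v = (a + b) * x + (m + l)" "m + l \<in> M" using Ma by (auto simp: algebra_simps)
      then show "u + v \<in> T" unfolding T_def by blast
    next
      fix u assume "u \<in> T"
      then obtain a m where "u = a * x + m" "m \<in> M" unfolding T_def by blast
      then have "- u = (- a) * x + (- m)" "- m \<in> M" using Mn by auto
      then show "- u \<in> T" unfolding T_def by blast
    next
      fix b u assume "u \<in> T"
      then obtain a m where "u = a * x + m" "m \<in> M" unfolding T_def by blast
      then have "lmul b u = (b * a) * x + b * m" "b * m \<in> M" using Mm
        by (auto simp: algebra_simps lmul_def)
      then show "lmul b u \<in> T" unfolding T_def by blast
    qed
    moreover have "M \<subseteq> T" unfolding T_def by (force intro: exI[of _ 0])
    moreover have "x \<in> T" unfolding T_def using M0 by (force intro: exI[of _ 1])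
    ultimately have "T = UNIV" using M xM unfolding maximal_submodule_def by blast
    then obtain a m where am: "1 = a * x + m" "m \<in> M" unfolding T_def by blast
    \<comment> \<open>Since \<open>a * x\<close> is congruent to \<open>1\<close> modulo the left
      ideal \<open>M\<close>, so are all its powers.\<close>
    have pow: "1 - (a * x) ^ k \<in> M" for k
    proof (induction k)
      case (Suc k)
      have "1 - (a * x) ^ Suc k = m + (a * x) * (1 - (a * x) ^ k)"
        using am(1) by (simp add: algebra_simps)
      then show ?case using Ma[OF am(2) Mm[OF Suc]] by metis
    qed (simp add: M0)
    obtain n where "(a * x) ^ n = 0" using nil by blast
    then have "1 \<in> M" using pow[of n] by simp
    then have "b \<in> M" for b using Mm[of 1 b] by simp
    then show False using sub(2) by auto
  qed
  then show "x \<in> jacobson_radical" by (auto simp: jacobson_radical_def)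
qed

text \<open>The radical is defined through left ideals; this mirrored criterion is what shows that
  it absorbs right multiplication.\<close>

lemma jacobson_radical_iff_right:
  fixes x :: "'a::{ring_1,finite}"
  shows "x \<in> jacobson_radical \<longleftrightarrow> (\<forall>a. \<exists>n. (x * a) ^ n = 0)"
  unfolding jacobson_radical_iff by (metis power_mult_swap mult_zero_left mult_zero_right)

lemma submodule_jacobson_radical: "submodule lmul (jacobson_radical :: 'a::ring_1 set)"
  by (auto simp: jacobson_radical_def maximal_submodule_def submodule_def)

lemma jacobson_radical_mult_left:
  "x \<in> jacobson_radical \<Longrightarrow> a * x \<in> (jacobson_radical :: 'a::ring_1 set)"
  using submodule_jacobson_radical by (auto simp: submodule_def lmul_def)

lemma jacobson_radical_mult_right:
  "x \<in> jacobson_radical \<Longrightarrow> x * a \<in> (jacobson_radical :: 'a::{ring_1,finite} set)"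
  unfolding jacobson_radical_iff_right by (metis mult.assoc)

section \<open>Counting with pairings, subgroups and idempotents\<close>

lemma card_pairing:
  fixes \<psi> :: "'a::{ring_1,finite} \<Rightarrow> complex"
  assumes \<psi>: "character_on UNIV \<psi>" and "add_subgroup G" "add_subgroup H"
  shows "card {x\<in>H. \<forall>b\<in>G. \<psi> (b * x) = 1} * card G = card {b\<in>G. \<forall>x\<in>H. \<psi> (b * x) = 1} * card H"
proof -
  have l: "character_on G (\<lambda>b. \<psi> (b * x))" for x
    using \<psi> by (simp add: character_on_def distrib_right)
  have r: "character_on H (\<lambda>x. \<psi> (b * x))" for b
    using \<psi> by (simp add: character_on_def distrib_left)
  \<comment> \<open>Double counting: each inner sum is a character sum, nonzero only when the fixed
    element pairs trivially with the whole other group.\<close>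
  have "of_nat (card {x\<in>H. \<forall>b\<in>G. \<psi> (b * x) = 1} * card G) = (\<Sum>x\<in>H. \<Sum>b\<in>G. \<psi> (b * x))"
    by (simp add: sum_character_on[OF _ assms(2) l] sum.If_cases Int_def)
  also have "\<dots> = (\<Sum>b\<in>G. \<Sum>x\<in>H. \<psi> (b * x))"
    by (rule sum.swap)
  also have "\<dots> = of_nat (card {b\<in>G. \<forall>x\<in>H. \<psi> (b * x) = 1} * card H)"
    by (simp add: sum_character_on[OF _ assms(3) r] sum.If_cases Int_def)
  finally show ?thesis by (simp only: of_nat_eq_iff)
qed

text \<open>The differences \<open>b - b'\<close> take at most \<open>CARD('v)\<close> values, and
  two pairs with the same difference differ by an element of \<open>B \<inter> B'\<close> in both
  components.\<close>

lemma card_add_subgroups_le: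
  fixes B B' :: "'v::{ab_group_add,finite} set"
  assumes "add_subgroup B" "add_subgroup B'"
  shows "card B * card B' \<le> card (B \<inter> B') * CARD('v)"
proof -
  define r where "r s = (SOME p. p \<in> B \<times> B' \<and> fst p - snd p = s)" for s
  have r: "r (b - b') \<in> B \<times> B' \<and> fst (r (b - b')) - snd (r (b - b')) = b - b'"
    if "b \<in> B" "b' \<in> B'" for b b'
    unfolding r_def by (rule someI[of _ "(b, b')"]) (use that in auto)
  define h where "h p = (fst p - fst (r (fst p - snd p)), fst p - snd p)" for p
  have "h p \<in> (B \<inter> B') \<times> UNIV" if p: "p \<in> B \<times> B'" for p
  proof -
    obtain b b' where bb: "p = (b, b')" "b \<in> B" "b' \<in> B'" using p by auto
    obtain c c' where c: "r (b - b') = (c, c')" by fastforce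
    have cc: "c \<in> B" "c' \<in> B'" "c - c' = b - b'" using r[OF bb(2,3)] c by auto
    have "b - c \<in> B" using assms bb cc by (simp add: add_subgroup_diff)
    moreover have "b - c = b' - c'" using cc(3) by (simp add: algebra_simps)
    moreover have "b' - c' \<in> B'" using assms bb cc by (simp add: add_subgroup_diff)
    ultimately show ?thesis using bb c by (simp add: h_def)
  qed
  moreover have "inj_on h (B \<times> B')" by (auto simp: inj_on_def h_def)
  ultimately have "card (B \<times> B') \<le> card ((B \<inter> B') \<times> (UNIV :: 'v set))"
    by (intro card_inj_on_le[of h] image_subsetI) simp_all
  then show ?thesis by (simp add: card_cartesian_product)
qed

text \<open>An element outside the radical has a right multiple that is not nilpotent. An idempotent
  power of it stays in \<open>I\<close> and, being nonzero, is not nilpotent either.\<close>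

lemma ex_idempotent_right_ideal:
  fixes I :: "'a::{ring_1,finite} set"
  assumes I: "\<And>a x. x \<in> I \<Longrightarrow> x * a \<in> I" and "\<not> I \<subseteq> jacobson_radical"
  obtains i where "i \<in> I" "i * i = i" "i \<notin> jacobson_radical"
proof -
  obtain x a where x: "x \<in> I" "\<And>n. (x * a) ^ n \<noteq> 0"
    using assms(2) jacobson_radical_iff_right by blast
  obtain n where n: "n > 0" "(x * a) ^ n * (x * a) ^ n = (x * a) ^ n"
    by (rule finite_monoid_power_idempotent)
  define i where "i = (x * a) ^ n"
  have "i = x * (a * (x * a) ^ (n - 1))"
    unfolding i_def using n(1) by (metis Suc_diff_1 mult.assoc power_Suc)
  then have "i \<in> I" using I x(1) by metis
  moreover have ii: "i * i = i" using n by (simp add: i_def)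
  moreover have "i \<notin> jacobson_radical"
  proof
    assume "i \<in> jacobson_radical"
    then obtain k where "(1 * i) ^ k = 0" unfolding jacobson_radical_iff by blast
    moreover have "i ^ Suc k = i" by (induction k) (use ii in auto)
    ultimately show False using x(2)[of n] i_def by simp
  qed
  ultimately show ?thesis by (rule that)
qed

section \<open>Generating characters\<close>

text \<open>
  Take \<open>\<psi>\<close> trivial on \<open>J\<close> for which the largest left ideal \<open>K\<close> in its kernel is as small as possible,
  and suppose \<open>K \<noteq> J\<close>.  The largest right ideal \<open>I\<close> in the kernel has the size of \<open>K\<close>, so it contains an
  idempotent \<open>i \<notin> J\<close>.  Replacing \<open>\<psi>\<close> by \<open>\<psi> y * \<phi> (i * y)\<close> cannot shrink \<open>K\<close>, whence \<open>i A K \<subseteq> J\<close>.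
  Counting the pairing \<open>\<psi> (b * x)\<close> on \<open>B \<times> A\<close>, where \<open>B\<close> is the left annihilator modulo \<open>J\<close> of
  \<open>B' = {x. i A x \<subseteq> J}\<close>, then contradicts \<open>B \<inter> B' \<subseteq> J\<close>.
\<close>

lemma ex_character_quotient_radical:
  fixes J :: "'a::{ring_1,finite} set"
  defines "J \<equiv> jacobson_radical"
  obtains \<psi> where "character_on UNIV \<psi>" "\<forall>x\<in>J. \<psi> x = 1" "{x. \<forall>a. \<psi> (a * x) = 1} = J"
proof -
  define K where "K \<psi> = {x::'a. \<forall>a. \<psi> (a * x) = (1::complex)}" for \<psi>
  \<comment> \<open>\<open>P\<close> selects the characters of \<open>A/J\<close>, viewed as
    characters of \<open>A\<close>.\<close>
  define P where "P \<psi> \<longleftrightarrow> character_on UNIV \<psi> \<and> (\<forall>x\<in>J. \<psi> x = 1)" for \<psi>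
  have "P (\<lambda>_. 1)" by (simp add: P_def character_on_def)
  then obtain \<psi> where \<psi>: "P \<psi>" "\<And>\<theta>. P \<theta> \<Longrightarrow> card (K \<psi>) \<le> card (K \<theta>)"
    using ex_has_least_nat[of P "\<lambda>_. 1" "\<lambda>\<psi>. card (K \<psi>)"] by blast
  have ch: "\<psi> 0 = 1" "\<And>x y. \<psi> (x + y) = \<psi> x * \<psi> y" and \<psi>J: "\<And>x. x \<in> J \<Longrightarrow> \<psi> x = 1"
    and ch': "character_on UNIV \<psi>"
    using \<psi>(1) by (auto simp: P_def character_on_def)
  have Jsub: "add_subgroup J"
    using submodule_jacobson_radical unfolding J_def by (rule submodule_add_subgroup)
  have Jl: "\<And>a x. x \<in> J \<Longrightarrow> a * x \<in> J" and Jr: "\<And>a x. x \<in> J \<Longrightarrow> x * a \<in> J"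
    unfolding J_def by (auto intro: jacobson_radical_mult_left jacobson_radical_mult_right)
  have JK: "J \<subseteq> K \<psi>" using \<psi>J Jl by (auto simp: K_def)
  define I where "I = {a. \<forall>x. \<psi> (a * x) = 1}"
  have JI: "J \<subseteq> I" using \<psi>J Jr by (auto simp: I_def)
  have IK: "card I = card (K \<psi>)"
    using card_pairing[OF ch', of UNIV UNIV] by (simp add: I_def K_def)
  have "K \<psi> = J"
  proof (rule ccontr)
    assume "K \<psi> \<noteq> J"
    then have "card J < card (K \<psi>)" using JK by (intro psubset_card_mono) auto
    then have "\<not> I \<subseteq> J" using IK card_mono[of J I] by auto
    moreover have Ir: "a * b \<in> I" if "a \<in> I" for a b using that by (auto simp: I_def mult.assoc)
    ultimately obtain i where i: "i \<in> I" "i * i = i" "i \<notin> J"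
      using ex_idempotent_right_ideal[of I] unfolding J_def by metis
    have iAK: "i * (a * x) \<in> J" if x: "x \<in> K \<psi>" for a x
    proof (rule ccontr)
      assume "i * (a * x) \<notin> J"
      with Jsub obtain \<phi> where \<phi>: "character_on UNIV \<phi>" "\<forall>x\<in>J. \<phi> x = 1" "\<phi> (i * (a * x)) \<noteq> 1"
        by (rule character_separates)
      define \<theta> where "\<theta> y = \<psi> y * \<phi> (i * y)" for y
      have "P \<theta>"
        using \<psi>(1) \<phi>(1,2) Jl by (auto simp: P_def character_on_def \<theta>_def distrib_left)
      then have le: "card (K \<psi>) \<le> card (K \<theta>)" by (rule \<psi>(2))
      \<comment> \<open>At \<open>i * b * y\<close> the factor from \<open>\<psi>\<close> is
        \<open>1\<close> because \<open>i \<in> I\<close>, and \<open>i * i = i\<close> leaves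
        \<open>\<phi> (i * (b * y)) = 1\<close>. Evaluation at \<open>b * y\<close> then isolates
        \<open>\<psi> (b * y)\<close>.\<close>
      have *: "\<phi> (i * (b * y)) = 1 \<and> \<psi> (b * y) = 1" if "y \<in> K \<theta>" for b y
      proof -
        have "\<theta> (i * b * y) = 1" "\<theta> (b * y) = 1" using that unfolding K_def by blast+
        moreover have "\<psi> (i * (b * y)) = 1" using i(1) by (auto simp: I_def)
        moreover have "i * (i * (b * y)) = i * (b * y)" using i(2) by (metis mult.assoc)
        ultimately show ?thesis by (simp add: \<theta>_def mult.assoc)
      qed
      then have "K \<theta> \<subseteq> K \<psi>" by (auto simp: K_def)
      with le have "K \<theta> = K \<psi>" by (intro card_seteq) auto
      then show False using *[of x a] x \<phi>(3) by simp
    qed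
    define B' where "B' = {x. \<forall>a. i * (a * x) \<in> J}"
    define B where "B = {b. \<forall>x\<in>B'. b * x \<in> J}"
    have J0: "0 \<in> J" and Ja: "\<And>x y. x \<in> J \<Longrightarrow> y \<in> J \<Longrightarrow> x + y \<in> J" and Jn: "\<And>x. x \<in> J \<Longrightarrow> - x \<in> J"
      using Jsub by (auto simp: add_subgroup_def)
    have B'sub: "add_subgroup B'"
      using J0 Ja Jn by (auto simp: add_subgroup_def B'_def distrib_left)
    have Bsub: "add_subgroup B"
      using J0 Ja Jn by (auto simp: add_subgroup_def B_def distrib_right)
    have B'l: "a * x \<in> B'" if "x \<in> B'" for a x
      unfolding B'_def
    proof (intro CollectI allI)
      fix b
      have "i * ((b * a) * x) \<in> J" using that unfolding B'_def by blast
      then show "i * (b * (a * x)) \<in> J" by (simp only: mult.assoc)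
    qed
    have Bl: "a * b \<in> B" if "b \<in> B" for a b
      using that Jl by (auto simp: B_def mult.assoc)
    have Br: "b * a \<in> B" if "b \<in> B" for a b
      using that B'l by (auto simp: B_def mult.assoc)
    have iB: "i \<in> B" 
      unfolding B_def
    proof (intro CollectI ballI)
      fix x assume "x \<in> B'"
      then have "i * (1 * x) \<in> J" unfolding B'_def by blast
      then show "i * x \<in> J" by simp
    qed
    have JB: "J \<subseteq> B" using Jr by (auto simp: B_def)
    \<comment> \<open>For \<open>x\<close> in both sets every \<open>a * x\<close> is in both as
      well, so its square lies in \<open>J\<close> and is nilpotent.\<close>
    have inter: "B \<inter> B' \<subseteq> J"
    proof
      fix x assume x: "x \<in> B \<inter> B'"
      have "\<exists>n. (a * x) ^ n = 0" for a
      proof -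
        have "(a * x) * (a * x) \<in> J" using x Bl B'l by (auto simp: B_def)
        then obtain n where "(1 * ((a * x) * (a * x))) ^ n = 0"
          unfolding J_def jacobson_radical_iff by blast
        then have "(a * x) ^ (2 * n) = 0" by (simp add: power_mult power2_eq_square)
        then show ?thesis by blast
      qed
      then show "x \<in> J" by (simp add: J_def jacobson_radical_iff)
    qed
    define KB where "KB = {x. \<forall>b\<in>B. \<psi> (b * x) = 1}"
    \<comment> \<open>Every \<open>c * i * a\<close> lies in \<open>B\<close>, hence
      \<open>i * a * x \<in> K \<psi>\<close>; then \<open>iAK\<close> together with
      \<open>i * i = i\<close> brings this element into \<open>J\<close>.\<close>
    have "KB \<subseteq> B'"
    proof
      fix x assume x: "x \<in> KB"
      have "i * (a * x) \<in> J" for a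
      proof -
        have "(i * a) * x \<in> K \<psi>"
          unfolding K_def using x Bl[OF Br[OF iB]] by (auto simp: KB_def simp flip: mult.assoc)
        from iAK[OF this, of 1] show ?thesis using i(2) by (simp flip: mult.assoc)
      qed
      then show "x \<in> B'" by (simp add: B'_def)
    qed
    \<comment> \<open>The counts chain to \<open>|B \<inter> I| |A| = |KB| |B| \<le> |B'| |B| \<le>
      |B \<inter> B'| |A|\<close>. Since \<open>J\<close> lies in \<open>B \<inter> I\<close> and
      misses \<open>i\<close>, this is incompatible with
      \<open>B \<inter> B' \<subseteq> J\<close>.\<close>
    have "card KB * card B = card (B \<inter> I) * CARD('a)"
      using card_pairing[OF ch' Bsub add_subgroup_UNIV] by (simp add: KB_def I_def Int_def)
    moreover have "card KB * card B \<le> card B' * card B"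
      using card_mono[OF _ \<open>KB \<subseteq> B'\<close>] by simp
    moreover have "card B * card B' \<le> card (B \<inter> B') * CARD('a)"
      by (rule card_add_subgroups_le[OF Bsub B'sub])
    moreover have "card (B \<inter> B') \<le> card J" using inter by (intro card_mono) auto
    moreover have "card J < card (B \<inter> I)" using JB JI i iB by (intro psubset_card_mono) auto
    ultimately have "card (B \<inter> I) * CARD('a) \<le> card (B \<inter> B') * CARD('a)"
      by (simp only: mult.commute[of "card B"])
    then show False using \<open>card (B \<inter> B') \<le> card J\<close> \<open>card J < card (B \<inter> I)\<close> by simp
  qed
  then show ?thesis using that[of \<psi>] \<psi>(1) by (auto simp: P_def K_def)
qed

lemma ex_generating_character:
  assumes "frobenius_ring TYPE('a)"
  obtains \<kappa> :: "'a::{ring_1,finite} \<Rightarrow> complex" where "character_on UNIV \<kappa>"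
    "\<And>x. (\<forall>a. \<kappa> (a * x) = 1) \<Longrightarrow> x = 0" "\<And>x. (\<forall>a. \<kappa> (x * a) = 1) \<Longrightarrow> x = 0"
proof -
  define J :: "'a set" where "J = jacobson_radical"
  define S :: "'a set" where "S = socle lmul"
  obtain \<psi> where \<psi>: "character_on UNIV \<psi>" "\<forall>x\<in>J. \<psi> x = 1" "{x. \<forall>a. \<psi> (a * x) = 1} = J"
    using ex_character_quotient_radical unfolding J_def by metis
  have \<psi>a: "\<psi> (x + y) = \<psi> x * \<psi> y" for x y using \<psi>(1) by (simp add: character_on_def)
  have Jsub: "add_subgroup J"
    using submodule_jacobson_radical unfolding J_def by (rule submodule_add_subgroup)
  obtain f where f: "bij_betw f S (cosets J)"
    "\<And>x y. x \<in> S \<Longrightarrow> y \<in> S \<Longrightarrow> f (x + y) = coset_add (f x) (f y)"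
    "\<And>a x. x \<in> S \<Longrightarrow> f (lmul a x) = coset_smul J lmul a (f x)"
    using assms unfolding frobenius_ring_def modules_isomorphic_def S_def J_def by metis
  have S: "submodule lmul S"
    unfolding S_def socle_def by (auto simp: submodule_def)
  have simple: "T \<subseteq> S" if "simple_submodule lmul T" for T
    using that unfolding S_def socle_def by auto
  have S0: "0 \<in> S" and Sa: "\<And>x y. x \<in> S \<Longrightarrow> y \<in> S \<Longrightarrow> x + y \<in> S"
    and Sm: "\<And>a x. x \<in> S \<Longrightarrow> a * x \<in> S"
    using S by (auto simp: submodule_def lmul_def)
  have J0: "0 \<in> J" using Jsub by (simp add: add_subgroup_def)
  have fc: "\<exists>u. f s = {u + j | j. j \<in> J}" if "s \<in> S" for s
    using bij_betwE[OF f(1)] that unfolding cosets_def by blast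
  have rep: "\<exists>u. u \<in> f s" if "s \<in> S" for s using fc[OF that] J0 by auto
  have dif: "u - v \<in> J" if s: "s \<in> S" and uv: "u \<in> f s" "v \<in> f s" for s u v
  proof -
    obtain w where "f s = {w + j | j. j \<in> J}" using fc[OF s] by blast
    then obtain j k where "u = w + j" "v = w + k" "j \<in> J" "k \<in> J" using uv by auto
    then show ?thesis using Jsub by (simp add: add_subgroup_diff)
  qed
  have uniq: "\<psi> u = \<psi> v" if "s \<in> S" "u \<in> f s" "v \<in> f s" for s u v
    using \<psi>a[of "u - v" v] \<psi>(2) dif[OF that] by simp
  have add: "u + v \<in> f (s + t)" if "s \<in> S" "t \<in> S" "u \<in> f s" "v \<in> f t" for s t u v
    using f(2)[OF that(1,2)] that(3,4) by (auto simp: coset_add_def)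
  have mult: "a * u \<in> f (a * s)" if "s \<in> S" "u \<in> f s" for s u a
    using f(3)[OF that(1), of a] that(2) J0 by (force simp: coset_smul_def lmul_def)
  have zero: "f 0 = J"
  proof -
    obtain u where u: "u \<in> f 0" using rep[OF S0] by blast
    \<comment> \<open>Because \<open>0 + 0 = 0\<close>, both \<open>u\<close> and
      \<open>u + u\<close> represent the coset \<open>f 0\<close>, so their difference
      \<open>u\<close> lies in \<open>J\<close>.\<close>
    have "u + u - u \<in> J" using add[OF S0 S0 u u] by (intro dif[OF S0 _ u]) simp
    then have uJ: "u \<in> J" by simp
    obtain w where w: "f 0 = {w + j | j. j \<in> J}" using fc[OF S0] by blast
    then obtain j where "u = w + j" "j \<in> J" using u by auto
    then have wJ: "w \<in> J" using add_subgroup_diff[OF Jsub uJ, of j] by simp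
    have "x \<in> f 0" if "x \<in> J" for x
      using add_subgroup_diff[OF Jsub that wJ] unfolding w by (auto intro!: exI[of _ "x - w"])
    moreover have "x \<in> J" if "x \<in> f 0" for x
      using that wJ Jsub unfolding w by (auto simp: add_subgroup_def)
    ultimately show ?thesis by blast
  qed
  \<comment> \<open>\<open>\<kappa>0\<close> is the pullback along \<open>f\<close> of the character
    that \<open>\<psi>\<close> induces on \<open>A/J\<close>; by \<open>uniq\<close> the chosen
    representative is immaterial.\<close>
  define \<kappa>0 where "\<kappa>0 s = \<psi> (SOME u. u \<in> f s)" for s
  have \<kappa>0: "\<kappa>0 s = \<psi> u" if "s \<in> S" "u \<in> f s" for s u
    unfolding \<kappa>0_def by (rule uniq[OF that(1) _ that(2)]) (rule someI[of "\<lambda>u. u \<in> f s", OF that(2)])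
  have "character_on S \<kappa>0"
    unfolding character_on_def
  proof (intro conjI ballI)
    show "\<kappa>0 0 = 1" using \<kappa>0[OF S0] zero J0 \<psi>(2) by auto
  next
    fix s t assume st: "s \<in> S" "t \<in> S"
    then obtain u v where "u \<in> f s" "v \<in> f t" using rep by blast
    then show "\<kappa>0 (s + t) = \<kappa>0 s * \<kappa>0 t"
      using \<kappa>0 st Sa add \<psi>a by metis
  qed
  then obtain \<kappa> where \<kappa>: "character_on UNIV \<kappa>" "\<forall>s\<in>S. \<kappa> s = \<kappa>0 s"
    using character_on_extend submodule_add_subgroup[OF S] by blast
  define L where "L = {x. \<forall>a. \<kappa> (a * x) = 1}"
  have "submodule lmul L"
  proof -
    have "\<kappa> (- x) = 1" if "\<kappa> x = 1" for x
      using \<kappa>(1) that unfolding character_on_def by (metis UNIV_I add.right_inverse mult_1)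
    then show ?thesis
      using \<kappa>(1) unfolding submodule_def L_def character_on_def lmul_def
      by (auto simp: distrib_left simp flip: mult.assoc)
  qed
  have L: "L = {0}"
  proof (rule ccontr)
    assume "L \<noteq> {0}"
    with \<open>submodule lmul L\<close> obtain T where T: "simple_submodule lmul T" "T \<subseteq> L"
      by (rule ex_simple_left_ideal)
    then obtain t where t: "t \<in> T" "t \<noteq> 0" by (auto simp: simple_submodule_def submodule_def)
    have tS: "t \<in> S" using simple[OF T(1)] t by blast
    obtain u where u: "u \<in> f t" using rep[OF tS] by blast
    \<comment> \<open>The left ideal generated by \<open>u\<close> lies in the kernel of
      \<open>\<psi>\<close>, so \<open>u \<in> J\<close>; then \<open>f t\<close> is the zero coset,
      against the injectivity of \<open>f\<close>.\<close>
    have "\<psi> (a * u) = 1" for a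
    proof -
      have "\<psi> (a * u) = \<kappa> (a * t)" using \<kappa>0[OF Sm mult] tS u \<kappa>(2) Sm by metis
      then show ?thesis using T(2) t(1) by (auto simp: L_def)
    qed
    then have uJ: "u \<in> J" using \<psi>(3) by blast
    obtain w where w: "f t = {w + j | j. j \<in> J}" using fc[OF tS] by blast
    then obtain j where "u = w + j" "j \<in> J" using u by auto
    then have "- w \<in> J" using add_subgroup_diff[OF Jsub \<open>j \<in> J\<close> uJ] by simp
    then have "w + - w \<in> f t" unfolding w by blast
    then have "0 \<in> f t" by simp
    have "f t = J"
    proof -
      have "x \<in> J" if "x \<in> f t" for x using dif[OF tS that \<open>0 \<in> f t\<close>] by simp
      moreover have "x \<in> f t" if "x \<in> J" for x
        using add[OF tS S0 \<open>0 \<in> f t\<close>, of x] that zero by simp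
      ultimately show ?thesis by blast
    qed
    then show False using f(1) zero tS S0 t(2) by (auto simp: bij_betw_def inj_on_def)
  qed
  \<comment> \<open>Pairing the ring with itself equates the sizes of the largest left and the
    largest right ideal in the kernel, so the right one is trivial too.\<close>
  have "card {x. \<forall>a. \<kappa> (a * x) = 1} = card {x. \<forall>a. \<kappa> (x * a) = 1}"
    using card_pairing[OF \<kappa>(1), of UNIV UNIV] by simp
  then have "card {x. \<forall>a. \<kappa> (x * a) = 1} = 1" using L by (simp add: L_def)
  moreover have "0 \<in> {x. \<forall>a. \<kappa> (x * a) = 1}" using \<kappa>(1) by (simp add: character_on_def)
  ultimately have "{x. \<forall>a. \<kappa> (x * a) = 1} = {0}" by (metis card_1_singletonE singletonD)
  then show ?thesis using that[of \<kappa>] \<kappa>(1) L by (auto simp: L_def)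
qed

section \<open>The MacWilliams identity\<close>

lemma bconst_add: "bconst (a + b) = bconst a + bconst b"
  by (simp add: bconst_def)

lemma bconst_mult: "bconst (a * b) = bconst a * bconst b"
  by (simp add: bconst_def)

lemma bconst_1: "bconst 1 = 1"
  by (simp add: bconst_def one_pCons)

lemma bconst_sum: "bconst (sum f S) = (\<Sum>x\<in>S. bconst (f x))"
  by (induction S rule: infinite_finite_induct) (simp_all add: bconst_add)

lemma bconst_prod: "bconst (prod f S) = (\<Prod>x\<in>S. bconst (f x))"
  by (induction S rule: infinite_finite_induct) (simp_all add: bconst_mult bconst_1)

text \<open>Writing the weight monomial as a product over coordinates is what lets the sum over all
  vectors factor.\<close>

lemma prod_if_zero_hamming_weight:
  fixes y :: "'a::zero^'m::finite" and U V :: "'b::comm_monoid_mult"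
  shows "(\<Prod>j\<in>UNIV. if y $ j = 0 then U else V) = U ^ (CARD('m) - hamming_weight y) * V ^ hamming_weight y"
proof -
  have "{j. y $ j = 0} = UNIV - {j. y $ j \<noteq> 0}" by auto
  then have "card {j. y $ j = 0} = CARD('m) - hamming_weight y"
    by (simp only: hamming_weight_def) (rule card_Diff_subset, auto)
  moreover have "- {j. y $ j = 0} = {j. y $ j \<noteq> 0}" by auto
  ultimately show ?thesis by (simp add: prod.If_cases hamming_weight_def)
qed

text \<open>Distributivity: expanding the product of sums gives one term for each function on the
  coordinates, that is, for each vector.\<close>

lemma sum_vec_prod:
  fixes h :: "'m::finite \<Rightarrow> 'a::finite \<Rightarrow> 'b::comm_semiring_1"
  shows "(\<Sum>y\<in>UNIV. \<Prod>j\<in>UNIV. h j ((y :: 'a^'m) $ j)) = (\<Prod>j\<in>UNIV. \<Sum>b\<in>UNIV. h j b)"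
proof -
  have "bij (vec_lambda :: ('m \<Rightarrow> 'a) \<Rightarrow> 'a^'m)"
    by (rule bij_betwI[where g = vec_nth]) auto
  then have "(\<Sum>y\<in>UNIV. \<Prod>j\<in>UNIV. h j ((y :: 'a^'m) $ j)) = (\<Sum>g\<in>UNIV. \<Prod>j\<in>UNIV. h j (g j))"
    by (subst sum.reindex_bij_betw[symmetric]) auto
  then show ?thesis by (simp add: prod_sum_PiE)
qed

lemma hamming_weight_bij:
  assumes "bij \<tau>" "\<And>j. v $ j = 0 \<longleftrightarrow> u $ \<tau> j = 0"
  shows "hamming_weight (v :: 'a::zero^'m::finite) = hamming_weight (u :: 'b::zero^'m)"
proof -
  have "bij_betw \<tau> {j. v $ j \<noteq> 0} {i. u $ i \<noteq> 0}"
    using assms unfolding bij_betw_def inj_on_def by (auto simp: image_iff)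
  then show ?thesis unfolding hamming_weight_def by (rule bij_betw_same_card)
qed

text \<open>This common core serves left and right codes. \<open>T c\<close> holds the entries that
  pair with the coordinates of \<open>y\<close>, and \<open>k\<close> is the pairing in one
  coordinate, which hides the order of multiplication.\<close>

lemma weight_enumerator_product_pairing:
  fixes C D :: "('a::{ring_1,finite}^'m::finite) set" and k :: "'a \<Rightarrow> 'a \<Rightarrow> complex"
  assumes C: "C \<noteq> {}"
    and D: "\<And>y. (\<Sum>c\<in>C. \<Prod>j\<in>UNIV. k (T c $ j) (y $ j)) = (if y \<in> D then of_nat (card C) else 0)"
    and k0: "\<And>w. k w 0 = 1"
    and k: "\<And>w. (\<Sum>b\<in>UNIV. k w b) = (if w = 0 then of_nat CARD('a) else 0)"
    and wt: "\<And>c. hamming_weight (T c) = hamming_weight c"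
  shows "weight_enumerator D = bconst (1 / of_nat (card C)) *
    bsubst (weight_enumerator C) (bX + bconst (of_nat CARD('a) - 1) * bY) (bX - bY)"
proof -
  define U where "U = bX + bconst (of_nat CARD('a) - 1) * bY"
  define g where "g b = (if b = 0 then bX else bY)" for b :: 'a
  have mono: "bX ^ (CARD('m) - hamming_weight y) * bY ^ hamming_weight y = (\<Prod>j\<in>UNIV. g (y $ j))"
    for y :: "'a^'m"
    unfolding g_def prod_if_zero_hamming_weight ..
  \<comment> \<open>The term \<open>b = 0\<close> contributes \<open>bX\<close>; the remaining
    values of \<open>k w\<close> sum to \<open>|A| - 1\<close> if \<open>w = 0\<close> and to
    \<open>-1\<close> otherwise.\<close>
  have inner: "(\<Sum>b\<in>UNIV. bconst (k w b) * g b) = (if w = 0 then U else bX - bY)" for w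
  proof -
    have "(\<Sum>b\<in>UNIV. k w b) = 1 + (\<Sum>b\<in>UNIV - {0}. k w b)"
      by (subst sum.remove[of _ 0]) (simp_all add: k0)
    then have r: "(\<Sum>b\<in>UNIV - {0}. k w b) = (if w = 0 then of_nat CARD('a) - 1 else - 1)"
      using k[of w] by (auto simp: algebra_simps eq_neg_iff_add_eq_0)
    have "(\<Sum>b\<in>UNIV. bconst (k w b) * g b) = bX + (\<Sum>b\<in>UNIV - {0}. bconst (k w b) * g b)"
      by (subst sum.remove[of _ 0]) (simp_all add: k0 g_def bconst_1)
    also have "(\<Sum>b\<in>UNIV - {0}. bconst (k w b) * g b) = (\<Sum>b\<in>UNIV - {0}. bconst (k w b) * bY)"
      by (rule sum.cong) (auto simp: g_def)
    also have "\<dots> = bconst (\<Sum>b\<in>UNIV - {0}. k w b) * bY"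
      by (simp only: bconst_sum sum_distrib_right)
    also have "\<dots> = (if w = 0 then bconst (of_nat CARD('a) - 1) * bY else - bY)"
    proof -
      have "bconst (- 1) * bY = - bY" by (simp add: bconst_def bY_def one_pCons)
      then show ?thesis unfolding r by simp
    qed
    finally show ?thesis by (simp add: U_def)
  qed
  have "bconst (of_nat (card C)) * weight_enumerator D =
      (\<Sum>y\<in>UNIV. bconst (if y \<in> D then of_nat (card C) else 0) * (\<Prod>j\<in>UNIV. g (y $ j)))"
  proof -
    have "(\<Sum>y\<in>UNIV. bconst (if y \<in> D then of_nat (card C) else 0) * (\<Prod>j\<in>UNIV. g (y $ j))) =
        (\<Sum>y\<in>UNIV. if y \<in> D then bconst (of_nat (card C)) * (\<Prod>j\<in>UNIV. g (y $ j)) else 0)"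
      by (rule sum.cong) auto
    then show ?thesis
      by (simp add: weight_enumerator_def mono sum_distrib_left sum.If_cases)
  qed
  \<comment> \<open>The indicator of \<open>D\<close>, scaled by \<open>|C|\<close>, is replaced by
    the character sum over \<open>C\<close>.\<close>
  also have "\<dots> = (\<Sum>y\<in>UNIV. \<Sum>c\<in>C. \<Prod>j\<in>UNIV. bconst (k (T c $ j) (y $ j)) * g (y $ j))"
    unfolding D[symmetric] bconst_sum bconst_prod sum_distrib_right prod.distrib ..
  also have "\<dots> = (\<Sum>c\<in>C. \<Sum>y\<in>UNIV. \<Prod>j\<in>UNIV. bconst (k (T c $ j) (y $ j)) * g (y $ j))"
    by (rule sum.swap)
  also have "\<dots> = (\<Sum>c\<in>C. \<Prod>j\<in>UNIV. if T c $ j = 0 then U else bX - bY)"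
    by (simp only: sum_vec_prod[of "\<lambda>j b. bconst (k (T _ $ j) b) * g b"] inner)
  also have "\<dots> = bsubst (weight_enumerator C) U (bX - bY)"
    by (simp only: prod_if_zero_hamming_weight bsubst_weight_enumerator wt)
  finally have e: "bconst (of_nat (card C)) * weight_enumerator D =
    bsubst (weight_enumerator C) U (bX - bY)" .
  have "card C \<noteq> 0" using C by simp
  then have "bconst (1 / of_nat (card C)) * bconst (of_nat (card C)) = 1"
    by (simp add: bconst_1 flip: bconst_mult)
  then have "weight_enumerator D =
      bconst (1 / of_nat (card C)) * (bconst (of_nat (card C)) * weight_enumerator D)"
    by (simp flip: mult.assoc)
  then show ?thesis unfolding e U_def .
qed

section \<open>The permutation of a monomial matrix and the form in coordinates\<close>

lemma monomial_matrix_permutation: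
  fixes Q :: "'a::ring_1^'m::finite^'m"
  assumes "monomial_matrix Q"
  shows "\<exists>\<sigma>. bij \<sigma> \<and> (\<forall>i j. Q $ i $ j \<noteq> 0 \<longleftrightarrow> j = \<sigma> i) \<and>
    (\<forall>i. \<exists>v. Q $ i $ \<sigma> i * v = 1 \<and> v * Q $ i $ \<sigma> i = 1)"
proof -
  note Q = assms[unfolded monomial_matrix_def]
  have r: "\<exists>!j. Q $ i $ j \<noteq> 0" for i by (rule spec[OF conjunct1[OF Q]])
  have c: "\<exists>!i. Q $ i $ j \<noteq> 0" for j by (rule spec[OF conjunct1[OF conjunct2[OF Q]]])
  have u: "\<exists>v. Q $ i $ j * v = 1 \<and> v * Q $ i $ j = 1" if "Q $ i $ j \<noteq> 0" for i j
    using conjunct2[OF conjunct2[OF Q]] that by simp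
  define \<sigma> where "\<sigma> i = (THE j. Q $ i $ j \<noteq> 0)" for i
  have \<sigma>: "Q $ i $ j \<noteq> 0 \<longleftrightarrow> j = \<sigma> i" for i j
    using theI'[OF r[of i]] the1_equality[OF r[of i]] unfolding \<sigma>_def by metis
  \<comment> \<open>Two rows with the same value of \<open>\<sigma>\<close> would put two nonzero
    entries into one column.\<close>
  have "inj \<sigma>" by (rule injI) (metis \<sigma> c)
  then have "bij \<sigma>" by (simp add: bij_def finite_UNIV_inj_surj)
  then show ?thesis using \<sigma> u by (intro exI[of _ \<sigma>]) simp
qed

text \<open>The vector \<open>y\<close> is the sum of the \<open>axis j 1\<close> acted on from the
  right by \<open>y $ j\<close>, the side on which the form is linear in its second
  argument.\<close>

lemma bilinear_form_expand_right:
  fixes \<beta> :: "'a::ring_1^'m::finite \<Rightarrow> 'a^'m \<Rightarrow> 'a"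
  assumes "bilinear_form \<beta>"
  shows "\<beta> x y = (\<Sum>j\<in>UNIV. \<beta> x (axis j 1) * y $ j)"
proof -
  have add: "\<beta> x (y + y') = \<beta> x y + \<beta> x y'" for y y'
    using assms by (simp add: bilinear_form_def)
  have "\<beta> x 0 = 0" using add[of 0 0] by simp
  with add have sum: "\<beta> x (sum h S) = (\<Sum>j\<in>S. \<beta> x (h j))" for h and S :: "'m set"
    by (induction S rule: infinite_finite_induct) simp_all
  have "\<beta> (1 *s x) (vec_rmul a y) = 1 * \<beta> x y * a" for a y
    using assms unfolding bilinear_form_def by blast
  then have smul: "\<beta> x (vec_rmul a y) = \<beta> x y * a" for a y by simp
  have y: "(\<Sum>j\<in>UNIV. vec_rmul (y $ j) (axis j 1)) = y"
    by (simp add: vec_eq_iff vec_rmul_def axis_def if_distrib[of "\<lambda>t. t * _"] cong: if_cong)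
  have "\<beta> x (\<Sum>j\<in>UNIV. vec_rmul (y $ j) (axis j 1)) = (\<Sum>j\<in>UNIV. \<beta> x (axis j 1) * y $ j)"
    by (simp only: sum smul)
  then show ?thesis by (simp only: y)
qed

lemma bilinear_form_expand_left:
  fixes \<beta> :: "'a::ring_1^'m::finite \<Rightarrow> 'a^'m \<Rightarrow> 'a"
  assumes "bilinear_form \<beta>"
  shows "\<beta> x y = (\<Sum>i\<in>UNIV. x $ i * \<beta> (axis i 1) y)"
proof -
  have add: "\<beta> (x + x') y = \<beta> x y + \<beta> x' y" for x x'
    using assms by (simp add: bilinear_form_def)
  have "\<beta> 0 y = 0" using add[of 0 0] by simp
  with add have sum: "\<beta> (sum h S) y = (\<Sum>j\<in>S. \<beta> (h j) y)" for h and S :: "'m set"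
    by (induction S rule: infinite_finite_induct) simp_all
  have "\<beta> (a *s x) (vec_rmul 1 y) = a * \<beta> x y * 1" for a x
    using assms unfolding bilinear_form_def by blast
  then have smul: "\<beta> (a *s x) y = a * \<beta> x y" for a x by (simp add: vec_rmul_def)
  have "\<beta> (\<Sum>i\<in>UNIV. x $ i *s axis i 1) y = (\<Sum>i\<in>UNIV. x $ i * \<beta> (axis i 1) y)"
    by (simp only: sum smul)
  then show ?thesis by (simp only: basis_expansion)
qed

theorem theorem30:
  fixes \<beta> :: "'a::{ring_1,finite}^'m::finite \<Rightarrow> 'a^'m \<Rightarrow> 'a"
    and C :: "('a^'m) set"
  assumes "frobenius_ring TYPE('a)"
    and "bilinear_form \<beta>"
    and "nondegenerate \<beta>"
    and "monomial_matrix (gram_matrix \<beta>)"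
  shows "(left_linear_code C \<longrightarrow>
            weight_enumerator (right_orthogonal \<beta> C) =
            bconst (1 / of_nat (card C)) *
              bsubst (weight_enumerator C) (bX + bconst (of_nat CARD('a) - 1) * bY) (bX - bY)) \<and>
         (right_linear_code C \<longrightarrow>
            weight_enumerator (left_orthogonal \<beta> C) =
            bconst (1 / of_nat (card C)) *
              bsubst (weight_enumerator C) (bX + bconst (of_nat CARD('a) - 1) * bY) (bX - bY))"
proof -
  obtain \<kappa> :: "'a \<Rightarrow> complex" where \<kappa>: "character_on UNIV \<kappa>"
    "\<And>x. (\<forall>a. \<kappa> (a * x) = 1) \<Longrightarrow> x = 0" "\<And>x. (\<forall>a. \<kappa> (x * a) = 1) \<Longrightarrow> x = 0"
    using ex_generating_character[OF assms(1)] by blast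
  have \<kappa>0: "\<kappa> 0 = 1" and \<kappa>a: "\<And>x y. \<kappa> (x + y) = \<kappa> x * \<kappa> y"
    using \<kappa>(1) by (auto simp: character_on_def)
  \<comment> \<open>The character \<open>b \<mapsto> \<kappa> (w * b)\<close> is trivial only if the
    right ideal generated by \<open>w\<close> lies in the kernel of \<open>\<kappa>\<close>, that
    is, only for \<open>w = 0\<close>.\<close>
  have kl: "(\<Sum>b\<in>UNIV. \<kappa> (w * b)) = (if w = 0 then of_nat CARD('a) else 0)" for w
  proof -
    have "character_on UNIV (\<lambda>b. \<kappa> (w * b))"
      by (simp add: character_on_def distrib_left \<kappa>0 \<kappa>a)
    from sum_character_on[OF _ _ this] \<kappa>(3)[of w] show ?thesis by (auto simp: \<kappa>0)
  qed
  have kr: "(\<Sum>b\<in>UNIV. \<kappa> (b * w)) = (if w = 0 then of_nat CARD('a) else 0)" for w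
  proof -
    have "character_on UNIV (\<lambda>b. \<kappa> (b * w))"
      by (simp add: character_on_def distrib_right \<kappa>0 \<kappa>a)
    from sum_character_on[OF _ _ this] \<kappa>(2)[of w] show ?thesis by (auto simp: \<kappa>0)
  qed
  have addl: "\<beta> (x + x') y = \<beta> x y + \<beta> x' y" and addr: "\<beta> x (y + y') = \<beta> x y + \<beta> x y'" for x x' y y'
    using assms(2) by (auto simp: bilinear_form_def)
  have zl: "\<beta> 0 y = 0" and zr: "\<beta> y 0 = 0" for y
    using addl[of 0 0 y] addr[of y 0 0] by simp_all
  have smul: "\<beta> (a *s x) (vec_rmul a' y) = a * \<beta> x y * a'" for a a' x y
    using assms(2) unfolding bilinear_form_def by blast
  have sl: "\<beta> (a *s x) y = a * \<beta> x y" for a x y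
    using smul[of a x 1 y] by (simp add: vec_rmul_def)
  have sr: "\<beta> x (vec_rmul a y) = \<beta> x y * a" for a x y
    using smul[of 1 x a y] by simp
  define Q where "Q = gram_matrix \<beta>"
  have Q: "\<beta> (axis i 1) (axis j 1) = Q $ i $ j" for i j
    by (simp add: Q_def gram_matrix_def)
  obtain \<sigma> where "bij \<sigma> \<and> (\<forall>i j. Q $ i $ j \<noteq> 0 \<longleftrightarrow> j = \<sigma> i) \<and>
      (\<forall>i. \<exists>v. Q $ i $ \<sigma> i * v = 1 \<and> v * Q $ i $ \<sigma> i = 1)"
    using monomial_matrix_permutation[OF assms(4)[folded Q_def]] ..
  then have \<sigma>: "bij \<sigma>" "\<And>i j. Q $ i $ j \<noteq> 0 \<longleftrightarrow> j = \<sigma> i"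
      "\<And>i. \<exists>v. Q $ i $ \<sigma> i * v = 1 \<and> v * Q $ i $ \<sigma> i = 1"
    by simp_all
  have Q0: "Q $ i $ j = 0" if "j \<noteq> \<sigma> i" for i j
    using \<sigma>(2)[of i j] that by blast
  have Q0': "Q $ l $ \<sigma> i = 0" if "l \<noteq> i" for i l
    by (rule Q0) (use that \<sigma>(1) in \<open>auto simp: bij_def inj_eq\<close>)
  have cancel: "x * Q $ i $ \<sigma> i = 0 \<longleftrightarrow> x = 0" "Q $ i $ \<sigma> i * x = 0 \<longleftrightarrow> x = 0" for x i
  proof -
    obtain v where v: "Q $ i $ \<sigma> i * v = 1" "v * Q $ i $ \<sigma> i = 1" using \<sigma>(3) by blast
    show "x * Q $ i $ \<sigma> i = 0 \<longleftrightarrow> x = 0" using v(1) by (metis mult.assoc mult_1_right mult_zero_left)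
    show "Q $ i $ \<sigma> i * x = 0 \<longleftrightarrow> x = 0" using v(2) by (metis mult.assoc mult_1_left mult_zero_right)
  qed
  \<comment> \<open>Here \<open>T c\<close> is the row vector \<open>c Q\<close>. Applying
    \<open>\<kappa>\<close> to the expansion of \<open>\<beta> c y\<close> along the coordinates of
    \<open>y\<close> gives the required product.\<close>
  have left: "weight_enumerator (right_orthogonal \<beta> C) = bconst (1 / of_nat (card C)) *
      bsubst (weight_enumerator C) (bX + bconst (of_nat CARD('a) - 1) * bY) (bX - bY)"
    if "left_linear_code C"
  proof (rule weight_enumerator_product_pairing
      [where k = "\<lambda>w b. \<kappa> (w * b)" and T = "\<lambda>c. \<chi> j. \<beta> c (axis j 1)"])
    have sub: "submodule (*s) C" using that by (simp add: left_linear_code_def)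
    then show "C \<noteq> {}" by (auto simp: submodule_def)
    show "hamming_weight (\<chi> j. \<beta> c (axis j 1)) = hamming_weight c" for c
    proof (rule hamming_weight_bij[symmetric, OF \<sigma>(1)])
      fix i
      \<comment> \<open>Column \<open>\<sigma> i\<close> of \<open>Q\<close> is nonzero only in row
        \<open>i\<close>, so coordinate \<open>\<sigma> i\<close> of \<open>T c\<close> is
        \<open>c $ i\<close> times a unit.\<close>
      have "\<beta> c (axis (\<sigma> i) 1) = (\<Sum>l\<in>UNIV. c $ l * Q $ l $ \<sigma> i)"
        by (subst bilinear_form_expand_left[OF assms(2)]) (simp add: Q)
      also have "\<dots> = (\<Sum>l\<in>{i}. c $ l * Q $ l $ \<sigma> i)"
        by (intro sum.mono_neutral_right) (auto simp: Q0')
      finally show "c $ i = 0 \<longleftrightarrow> (\<chi> j. \<beta> c (axis j 1)) $ \<sigma> i = 0" by (simp add: cancel)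
    qed
    fix y
    have "(\<Prod>j\<in>UNIV. \<kappa> ((\<chi> j. \<beta> c (axis j 1)) $ j * y $ j)) = \<kappa> (\<beta> c y)" for c
      by (subst bilinear_form_expand_right[OF assms(2)]) (simp add: character_on_sum[OF \<kappa>(1)])
    moreover have "(\<Sum>c\<in>C. \<kappa> (\<beta> c y)) = (if y \<in> right_orthogonal \<beta> C then of_nat (card C) else 0)"
    proof -
      have "character_on C (\<lambda>c. \<kappa> (\<beta> c y))"
        by (simp add: character_on_def zl addl \<kappa>0 \<kappa>a)
      moreover have "(\<forall>c\<in>C. \<kappa> (\<beta> c y) = 1) \<longleftrightarrow> y \<in> right_orthogonal \<beta> C"
      proof
        assume 1: "\<forall>c\<in>C. \<kappa> (\<beta> c y) = 1"
        \<comment> \<open>The values \<open>\<beta> c y\<close> with \<open>c \<in> C\<close> are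
          stable under left multiplication, so \<open>\<kappa>\<close> is trivial on the left ideal
          generated by each of them.\<close>
        have "\<beta> c y = 0" if "c \<in> C" for c
        proof (intro \<kappa>(2) allI)
          fix a
          have "a *s c \<in> C" using sub that by (simp add: submodule_def)
          then show "\<kappa> (a * \<beta> c y) = 1" using 1 sl by metis
        qed
        then show "y \<in> right_orthogonal \<beta> C" by (simp add: right_orthogonal_def)
      qed (simp add: right_orthogonal_def \<kappa>0)
      ultimately show ?thesis
        using sum_character_on[OF _ submodule_add_subgroup[OF sub]] by simp
    qed
    ultimately show "(\<Sum>c\<in>C. \<Prod>j\<in>UNIV. \<kappa> ((\<chi> j. \<beta> c (axis j 1)) $ j * y $ j)) =
        (if y \<in> right_orthogonal \<beta> C then of_nat (card C) else 0)" by simp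
  qed (simp_all add: \<kappa>0 kl)
  \<comment> \<open>Here \<open>T c\<close> is the column vector \<open>Q c\<close>, whose
    coordinate \<open>i\<close> is a unit times \<open>c $ \<sigma> i\<close>, and \<open>k\<close>
    multiplies in the opposite order.\<close>
  have right: "weight_enumerator (left_orthogonal \<beta> C) = bconst (1 / of_nat (card C)) *
      bsubst (weight_enumerator C) (bX + bconst (of_nat CARD('a) - 1) * bY) (bX - bY)"
    if "right_linear_code C"
  proof (rule weight_enumerator_product_pairing
      [where k = "\<lambda>w b. \<kappa> (b * w)" and T = "\<lambda>c. \<chi> i. \<beta> (axis i 1) c"])
    have sub: "submodule vec_rmul C" using that by (simp add: right_linear_code_def)
    then show "C \<noteq> {}" by (auto simp: submodule_def)
    show "hamming_weight (\<chi> i. \<beta> (axis i 1) c) = hamming_weight c" for c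
    proof (rule hamming_weight_bij[OF \<sigma>(1)])
      fix i
      have "\<beta> (axis i 1) c = (\<Sum>l\<in>UNIV. Q $ i $ l * c $ l)"
        by (subst bilinear_form_expand_right[OF assms(2)]) (simp add: Q)
      also have "\<dots> = (\<Sum>l\<in>{\<sigma> i}. Q $ i $ l * c $ l)"
      proof (rule sum.mono_neutral_right)
        show "\<forall>l\<in>UNIV - {\<sigma> i}. Q $ i $ l * c $ l = 0"
          using Q0[of _ i] by simp
      qed simp_all
      finally show "(\<chi> i. \<beta> (axis i 1) c) $ i = 0 \<longleftrightarrow> c $ \<sigma> i = 0" by (simp add: cancel)
    qed
    fix x
    have "(\<Prod>i\<in>UNIV. \<kappa> (x $ i * (\<chi> i. \<beta> (axis i 1) c) $ i)) = \<kappa> (\<beta> x c)" for c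
      by (subst bilinear_form_expand_left[OF assms(2)]) (simp add: character_on_sum[OF \<kappa>(1)])
    moreover have "(\<Sum>c\<in>C. \<kappa> (\<beta> x c)) = (if x \<in> left_orthogonal \<beta> C then of_nat (card C) else 0)"
    proof -
      have "character_on C (\<lambda>c. \<kappa> (\<beta> x c))"
        by (simp add: character_on_def zr addr \<kappa>0 \<kappa>a)
      moreover have "(\<forall>c\<in>C. \<kappa> (\<beta> x c) = 1) \<longleftrightarrow> x \<in> left_orthogonal \<beta> C"
      proof
        assume 1: "\<forall>c\<in>C. \<kappa> (\<beta> x c) = 1"
        have "\<beta> x c = 0" if "c \<in> C" for c
        proof (intro \<kappa>(3) allI)
          fix a
          have "vec_rmul a c \<in> C" using sub that by (simp add: submodule_def)
          then show "\<kappa> (\<beta> x c * a) = 1" using 1 sr by metis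
        qed
        then show "x \<in> left_orthogonal \<beta> C" by (simp add: left_orthogonal_def)
      qed (simp add: left_orthogonal_def \<kappa>0)
      ultimately show ?thesis
        using sum_character_on[OF _ submodule_add_subgroup[OF sub]] by simp
    qed
    ultimately show "(\<Sum>c\<in>C. \<Prod>i\<in>UNIV. \<kappa> (x $ i * (\<chi> i. \<beta> (axis i 1) c) $ i)) =
        (if x \<in> left_orthogonal \<beta> C then of_nat (card C) else 0)" by simp
  qed (simp_all add: \<kappa>0 kr)
  from left right show ?thesis by blast
qed

end
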